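(* Let $R$ be a ring and let $M=M_1\oplus\cdots\oplus M_n$ be a right $R$-module which is a $C_2$ module. If $M_i$ is relatively CS-Rickart to $M_j$ for all $i,j\in\{1,\ldots,n\}$, then $M$ is a CS-Rickart module.
   Context: All rings are associative with nonzero identity; modules are unitary right modules. A module $M$ is a $C_2$ module if every submodule of $M$ that is isomorphic to a direct summand of $M$ is itself a direct summand of $M$. A module $M$ is relatively CS-Rickart to a module $N$ if for every $\varphi\in\mathrm{Hom}_R(M,N)$, $\mathrm{Ker}\,\varphi$ is an essential submodule of a direct summand of $M$. A module $M$ is CS-Rickart if for every $\varphi\in\mathrm{End}_R(M)$, $\mathrm{Ker}\,\varphi$ is an essential submodule of a direct summand of $M$. *)

theory Defs
  imports "HOL-Algebra.AbelCoset" "HOL-Algebra.Module"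
begin

text \<open>
  \<^locale>\<open>module\<close> in HOL-Algebra is restricted to commutative rings. Right modules over an
  arbitrary ring are based on the same record, so that \<^const>\<open>submodule\<close> can be reused.
  The record takes the scalar as first argument, so the right action \<open>x \<cdot> r\<close> is written
  \<open>r \<odot>\<^bsub>M\<^esub> x\<close>. The side shows in \<open>rsmult_assoc\<close>, which reads \<open>x \<cdot> (a b) = (x \<cdot> a) \<cdot> b\<close>.
\<close>

locale right_module = R?: ring R + M?: abelian_group M
  for R (structure) and M (structure) +
  assumes rsmult_closed [simp, intro]:
      "\<lbrakk>a \<in> carrier R; x \<in> carrier M\<rbrakk> \<Longrightarrow> a \<odot>\<^bsub>M\<^esub> x \<in> carrier M"
    and rsmult_ring_distr:
      "\<lbrakk>a \<in> carrier R; b \<in> carrier R; x \<in> carrier M\<rbrakk> \<Longrightarrow>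
        (a \<oplus>\<^bsub>R\<^esub> b) \<odot>\<^bsub>M\<^esub> x = a \<odot>\<^bsub>M\<^esub> x \<oplus>\<^bsub>M\<^esub> b \<odot>\<^bsub>M\<^esub> x"
    and rsmult_module_distr:
      "\<lbrakk>a \<in> carrier R; x \<in> carrier M; y \<in> carrier M\<rbrakk> \<Longrightarrow>
        a \<odot>\<^bsub>M\<^esub> (x \<oplus>\<^bsub>M\<^esub> y) = a \<odot>\<^bsub>M\<^esub> x \<oplus>\<^bsub>M\<^esub> a \<odot>\<^bsub>M\<^esub> y"
    and rsmult_assoc:
      "\<lbrakk>a \<in> carrier R; b \<in> carrier R; x \<in> carrier M\<rbrakk> \<Longrightarrow>
        (a \<otimes>\<^bsub>R\<^esub> b) \<odot>\<^bsub>M\<^esub> x = b \<odot>\<^bsub>M\<^esub> (a \<odot>\<^bsub>M\<^esub> x)"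
    and rsmult_one [simp]:
      "x \<in> carrier M \<Longrightarrow> \<one>\<^bsub>R\<^esub> \<odot>\<^bsub>M\<^esub> x = x"

text \<open>A submodule \<open>H\<close> of \<open>M\<close>, regarded as a module in its own right, is \<open>M\<lparr>carrier := H\<rparr>\<close>.\<close>

lemma (in right_module) submodule_is_right_module:
  assumes "submodule H R M"
  shows "right_module R (M\<lparr>carrier := H\<rparr>)"
proof -
  interpret H: submodule H R M by (rule assms)
  have sub: "\<And>x. x \<in> H \<Longrightarrow> x \<in> carrier M"
    using H.subset by auto
  have cm: "comm_monoid (add_monoid (M\<lparr>carrier := H\<rparr>))"
    using comm_monoid.submonoid_is_comm_monoid[OF M.a_comm_monoid H.subgroup_is_submonoid] by simp
  have "group (add_monoid (M\<lparr>carrier := H\<rparr>))"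
    using H.subgroup_is_group[OF M.a_group] by simp
  with cm have "abelian_group (M\<lparr>carrier := H\<rparr>)"
    by (intro abelian_group.intro abelian_monoid.intro abelian_group_axioms.intro
        comm_group.intro) auto
  then show ?thesis
    by (intro right_module.intro right_module_axioms.intro R.ring_axioms)
      (auto simp: sub rsmult_ring_distr rsmult_module_distr rsmult_assoc)
qed

definition module_Hom ::
    "('a, 'r) ring_scheme \<Rightarrow> ('a, 'b, 'm) module_scheme \<Rightarrow> ('a, 'c, 'n) module_scheme \<Rightarrow> ('b \<Rightarrow> 'c) set"
  where "module_Hom R M N =
    {\<phi> \<in> carrier M \<rightarrow> carrier N.
      (\<forall>x\<in>carrier M. \<forall>y\<in>carrier M. \<phi> (x \<oplus>\<^bsub>M\<^esub> y) = \<phi> x \<oplus>\<^bsub>N\<^esub> \<phi> y) \<and>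
      (\<forall>r\<in>carrier R. \<forall>x\<in>carrier M. \<phi> (r \<odot>\<^bsub>M\<^esub> x) = r \<odot>\<^bsub>N\<^esub> \<phi> x)}"

definition module_isomorphic ::
    "('a, 'r) ring_scheme \<Rightarrow> ('a, 'b, 'm) module_scheme \<Rightarrow> ('a, 'c, 'n) module_scheme \<Rightarrow> bool"
  where "module_isomorphic R M N \<longleftrightarrow>
    (\<exists>\<phi>\<in>module_Hom R M N. bij_betw \<phi> (carrier M) (carrier N))"

definition direct_summand ::
    "'b set \<Rightarrow> ('a, 'r) ring_scheme \<Rightarrow> ('a, 'b, 'm) module_scheme \<Rightarrow> bool"
  where "direct_summand D R M \<longleftrightarrow> submodule D R M \<and>
    (\<exists>D'. submodule D' R M \<and> D <+>\<^bsub>M\<^esub> D' = carrier M \<and> D \<inter> D' = {\<zero>\<^bsub>M\<^esub>})"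

definition essential_submodule ::
    "'b set \<Rightarrow> ('a, 'r) ring_scheme \<Rightarrow> ('a, 'b, 'm) module_scheme \<Rightarrow> bool"
  where "essential_submodule K R M \<longleftrightarrow> submodule K R M \<and>
    (\<forall>L. submodule L R M \<and> L \<noteq> {\<zero>\<^bsub>M\<^esub>} \<longrightarrow> K \<inter> L \<noteq> {\<zero>\<^bsub>M\<^esub>})"

text \<open>
  Internal direct sum \<open>M = (\<Oplus>i\<in>I. N i)\<close> of finitely many submodules: each element of \<open>M\<close> is
  a sum of components in the \<open>N i\<close> in exactly one way. The families \<open>f\<close> are extensional
  (\<open>Pi\<^sub>E\<close>), since otherwise their values outside \<open>I\<close> would spoil uniqueness.
\<close>

definition finite_direct_sum ::
    "('a, 'r) ring_scheme \<Rightarrow> ('a, 'b, 'm) module_scheme \<Rightarrow> 'i set \<Rightarrow> ('i \<Rightarrow> 'b set) \<Rightarrow> bool"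
  where "finite_direct_sum R M I N \<longleftrightarrow> finite I \<and> (\<forall>i\<in>I. submodule (N i) R M) \<and>
    (\<forall>x\<in>carrier M. \<exists>!f. f \<in> Pi\<^sub>E I N \<and> x = (\<Oplus>\<^bsub>M\<^esub>i\<in>I. f i))"

definition C2_module :: "('a, 'r) ring_scheme \<Rightarrow> ('a, 'b, 'm) module_scheme \<Rightarrow> bool"
  where "C2_module R M \<longleftrightarrow>
    (\<forall>K D. submodule K R M \<and> direct_summand D R M \<and>
      module_isomorphic R (M\<lparr>carrier := K\<rparr>) (M\<lparr>carrier := D\<rparr>) \<longrightarrow> direct_summand K R M)"

definition relatively_CS_Rickart ::
    "('a, 'r) ring_scheme \<Rightarrow> ('a, 'b, 'm) module_scheme \<Rightarrow> ('a, 'c, 'n) module_scheme \<Rightarrow> bool"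
  where "relatively_CS_Rickart R M N \<longleftrightarrow>
    (\<forall>\<phi>\<in>module_Hom R M N. \<exists>D. direct_summand D R M \<and>
      essential_submodule (a_kernel M N \<phi>) R (M\<lparr>carrier := D\<rparr>))"

definition CS_Rickart :: "('a, 'r) ring_scheme \<Rightarrow> ('a, 'b, 'm) module_scheme \<Rightarrow> bool"
  where "CS_Rickart R M \<longleftrightarrow>
    (\<forall>\<phi>\<in>module_Hom R M M. \<exists>D. direct_summand D R M \<and>
      essential_submodule (a_kernel M M \<phi>) R (M\<lparr>carrier := D\<rparr>))"

end

theory Submission
  imports Defs
begin

text \<open>
  Let \<open>\<phi>\<close> be an endomorphism of \<open>M\<close> with kernel \<open>K\<close>. If every \<open>K \<inter> N i\<close> is essential in \<open>N i\<close>,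
  then \<open>K\<close> is essential in \<open>M\<close> (\<open>essential_if_essential_components\<close>) and nothing remains to be
  shown. In general the kernel is enlarged, one component at a time, until this is the case, and
  the conclusion is then carried back from the enlarged kernels to \<open>K\<close>.

  The first ingredient is that \<open>K \<inter> N i\<close> is at least essential in a summand \<open>D\<close> of \<open>N i\<close>. It is
  the intersection of the kernels of the maps \<open>\<pi> j \<circ> \<phi>\<close> from \<open>N i\<close> to \<open>N j\<close>, where \<open>\<pi> j\<close> is the
  projection onto \<open>N j\<close>, and finite intersections of such kernels stay essential in a summand
  (\<open>relatively_CS_Rickart_Int_kernels\<close>).

  Write \<open>N i = D \<oplus> C\<close>. Then \<open>C\<close> meets \<open>K\<close> trivially, so \<open>\<phi>\<close> maps \<open>C\<close> isomorphically onto \<open>\<phi> ` C\<close>.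
  As \<open>C\<close> is a summand of \<open>M\<close>, the \<open>C2\<close> condition makes \<open>\<phi> ` C\<close> a summand too. The
  preimage under \<open>\<phi>\<close> of a complement of \<open>\<phi> ` C\<close> is then a complement \<open>P\<close> of \<open>C\<close> that contains \<open>K\<close>
  (\<open>C2_projection_vanishing_on_kernel\<close>). Let \<open>p\<close> be the projection onto \<open>P\<close> along \<open>C\<close>. The
  endomorphism \<open>\<phi> \<circ> p\<close> has kernel \<open>K \<oplus> C\<close>. This contains \<open>K\<close>, and it meets \<open>N i\<close> in an essential
  submodule, because \<open>K \<inter> N i\<close> is essential in \<open>D\<close> and \<open>N i = D \<oplus> C\<close>. So \<open>i\<close> is settled without
  losing any earlier component (\<open>enlarge_kernel\<close>).

  The way back is the modular law: if \<open>K \<oplus> C\<close> is essential in a summand \<open>E\<close>, then \<open>K\<close> is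
  essential in \<open>E \<inter> P\<close>, which is a summand as well (\<open>essential_in_summand_if_vimage\<close>). The same
  statement drives the induction for intersections of kernels.

  Summands are handled through projections. Then a submodule such as \<open>K \<oplus> C\<close> is the preimage of
  \<open>K\<close> under \<open>p\<close>, and essentiality is moved around by one principle: preimages of essential
  submodules under homomorphisms are essential (\<open>essential_vimage\<close>).
\<close>

section \<open>Submodules and homomorphisms\<close>

lemma (in right_module) minus_one_rsmult:
  assumes "x \<in> carrier M"
  shows "(\<ominus>\<^bsub>R\<^esub> \<one>\<^bsub>R\<^esub>) \<odot>\<^bsub>M\<^esub> x = \<ominus>\<^bsub>M\<^esub> x"
proof -
  have z: "\<zero>\<^bsub>R\<^esub> \<odot>\<^bsub>M\<^esub> x = \<zero>\<^bsub>M\<^esub>"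
  proof -
    have "\<zero>\<^bsub>R\<^esub> \<odot>\<^bsub>M\<^esub> x \<oplus>\<^bsub>M\<^esub> \<zero>\<^bsub>R\<^esub> \<odot>\<^bsub>M\<^esub> x = \<zero>\<^bsub>R\<^esub> \<odot>\<^bsub>M\<^esub> x"
      using rsmult_ring_distr[of "\<zero>\<^bsub>R\<^esub>" "\<zero>\<^bsub>R\<^esub>" x] assms by simp
    then show ?thesis
      using assms M.add.r_cancel_one by blast
  qed
  have "x \<oplus>\<^bsub>M\<^esub> (\<ominus>\<^bsub>R\<^esub> \<one>\<^bsub>R\<^esub>) \<odot>\<^bsub>M\<^esub> x = (\<one>\<^bsub>R\<^esub> \<oplus>\<^bsub>R\<^esub> \<ominus>\<^bsub>R\<^esub> \<one>\<^bsub>R\<^esub>) \<odot>\<^bsub>M\<^esub> x"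
    using assms by (simp only: rsmult_ring_distr R.one_closed R.a_inv_closed rsmult_one)
  also have "\<dots> = \<zero>\<^bsub>M\<^esub>"
    using z R.r_neg by simp
  finally have "x \<oplus>\<^bsub>M\<^esub> (\<ominus>\<^bsub>R\<^esub> \<one>\<^bsub>R\<^esub>) \<odot>\<^bsub>M\<^esub> x = \<zero>\<^bsub>M\<^esub>" .
  then show ?thesis
    using assms M.minus_equality[of "(\<ominus>\<^bsub>R\<^esub> \<one>\<^bsub>R\<^esub>) \<odot>\<^bsub>M\<^esub> x" x]
    by (simp add: M.a_comm[of _ x])
qed

text \<open>
  Addition, zero and scalar multiplication of \<open>M\<lparr>carrier := D\<rparr>\<close> are by definition those of \<open>M\<close>,
  but negation is not, since inverses are sought in the carrier. Closure under negation is closure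
  under multiplication by \<open>-1\<close>, so a criterion can avoid it; this form makes the passage between
  \<open>M\<close> and its submodules a matter of rewriting.
\<close>

lemma (in right_module) submodule_iff:
  "submodule H R M \<longleftrightarrow> H \<subseteq> carrier M \<and> \<zero>\<^bsub>M\<^esub> \<in> H \<and> (\<forall>x\<in>H. \<forall>y\<in>H. x \<oplus>\<^bsub>M\<^esub> y \<in> H) \<and>
    (\<forall>a\<in>carrier R. \<forall>x\<in>H. a \<odot>\<^bsub>M\<^esub> x \<in> H)" (is "_ \<longleftrightarrow> ?C")
proof
  assume "submodule H R M"
  then interpret H: submodule H R M .
  show ?C
    using H.subset H.one_closed H.m_closed by auto
next
  assume C: ?C
  show "submodule H R M"
  proof (intro submodule.intro subgroup.intro submodule_axioms.intro)
    fix x assume x: "x \<in> H"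
    then have "(\<ominus>\<^bsub>R\<^esub> \<one>\<^bsub>R\<^esub>) \<odot>\<^bsub>M\<^esub> x \<in> H"
      using C by simp
    then show "inv\<^bsub>add_monoid M\<^esub> x \<in> H"
      using minus_one_rsmult[of x] x C unfolding a_inv_def by (metis subsetD)
  qed (use C in auto)
qed

context right_module
begin

lemma submodule_minus:
  assumes "submodule H R M" "x \<in> H" "y \<in> H"
  shows "x \<ominus>\<^bsub>M\<^esub> y \<in> H"
proof -
  interpret H: submodule H R M by fact
  show ?thesis
    using assms(2) H.m_inv_closed[OF assms(3)] by (simp add: a_minus_def a_inv_def H.m_closed[simplified])
qed

lemma submodule_restrict_iff:
  assumes "submodule D R M"
  shows "submodule H R (M\<lparr>carrier := D\<rparr>) \<longleftrightarrow> submodule H R M \<and> H \<subseteq> D"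
proof -
  interpret D: right_module R "M\<lparr>carrier := D\<rparr>"
    by (rule submodule_is_right_module[OF assms])
  show ?thesis
    using assms D.submodule_iff[of H] submodule_iff[of H] submodule_iff[of D] by auto
qed

lemma submodule_subset: "submodule H R M \<Longrightarrow> H \<subseteq> carrier M"
  by (simp add: submodule_iff)

lemma carrier_submodule: "submodule (carrier M) R M"
  by (simp add: submodule_iff)

lemma rsmult_zero: "r \<in> carrier R \<Longrightarrow> r \<odot>\<^bsub>M\<^esub> \<zero>\<^bsub>M\<^esub> = \<zero>\<^bsub>M\<^esub>"
  using rsmult_module_distr[of r "\<zero>\<^bsub>M\<^esub>" "\<zero>\<^bsub>M\<^esub>"]
    M.add.r_cancel_one[of "r \<odot>\<^bsub>M\<^esub> \<zero>\<^bsub>M\<^esub>" "r \<odot>\<^bsub>M\<^esub> \<zero>\<^bsub>M\<^esub>"] by simp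

lemma zero_submodule: "submodule {\<zero>\<^bsub>M\<^esub>} R M"
  by (simp add: submodule_iff rsmult_zero)

lemma submodule_Int: "submodule H R M \<Longrightarrow> submodule L R M \<Longrightarrow> submodule (H \<inter> L) R M"
  by (auto simp: submodule_iff)

lemma Hom_inclusion: "submodule H R M \<Longrightarrow> (\<lambda>x. x) \<in> module_Hom R (M\<lparr>carrier := H\<rparr>) M"
  by (auto simp: submodule_iff module_Hom_def)

end

lemma Hom_add:
  "\<lbrakk>f \<in> module_Hom R A B; x \<in> carrier A; y \<in> carrier A\<rbrakk> \<Longrightarrow> f (x \<oplus>\<^bsub>A\<^esub> y) = f x \<oplus>\<^bsub>B\<^esub> f y"
  by (auto simp: module_Hom_def)

lemma Hom_smult:
  "\<lbrakk>f \<in> module_Hom R A B; r \<in> carrier R; x \<in> carrier A\<rbrakk> \<Longrightarrow> f (r \<odot>\<^bsub>A\<^esub> x) = r \<odot>\<^bsub>B\<^esub> f x"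
  by (auto simp: module_Hom_def)

lemma Hom_closed: "\<lbrakk>f \<in> module_Hom R A B; x \<in> carrier A\<rbrakk> \<Longrightarrow> f x \<in> carrier B"
  by (auto simp: module_Hom_def)

lemma Hom_compose:
  assumes "f \<in> module_Hom R A B" "g \<in> module_Hom R B C"
  shows "(\<lambda>x. g (f x)) \<in> module_Hom R A C"
  using assms by (fastforce simp: module_Hom_def Pi_iff)

lemma Hom_abelian_group_hom:
  assumes "right_module R A" "right_module R B" "f \<in> module_Hom R A B"
  shows "abelian_group_hom A B f"
proof -
  interpret A: right_module R A by fact
  interpret B: right_module R B by fact
  show ?thesis
    using assms(3) A.abelian_group_axioms B.abelian_group_axioms A.add.group_axioms B.add.group_axioms
    by (intro abelian_group_homI group_hom.intro group_hom_axioms.intro)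
      (auto simp: hom_def module_Hom_def)
qed

lemma Hom_zero:
  assumes "right_module R A" "right_module R B" "f \<in> module_Hom R A B"
  shows "f \<zero>\<^bsub>A\<^esub> = \<zero>\<^bsub>B\<^esub>"
  using abelian_group_hom.hom_zero[OF Hom_abelian_group_hom[OF assms]] .

lemma Hom_minus:
  assumes "right_module R A" "right_module R B" "f \<in> module_Hom R A B"
    and "x \<in> carrier A" "y \<in> carrier A"
  shows "f (x \<ominus>\<^bsub>A\<^esub> y) = f x \<ominus>\<^bsub>B\<^esub> f y"
proof -
  interpret f: abelian_group_hom A B f
    by (rule Hom_abelian_group_hom[OF assms(1-3)])
  show ?thesis
    using assms by (simp add: a_minus_def)
qed

lemma (in right_module) Hom_diff:
  assumes "right_module R A" "f \<in> module_Hom R A M" "g \<in> module_Hom R A M"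
  shows "(\<lambda>x. f x \<ominus>\<^bsub>M\<^esub> g x) \<in> module_Hom R A M"
proof -
  interpret A: right_module R A by fact
  have minus: "r \<odot>\<^bsub>M\<^esub> (\<ominus>\<^bsub>M\<^esub> x) = \<ominus>\<^bsub>M\<^esub> (r \<odot>\<^bsub>M\<^esub> x)" if "r \<in> carrier R" "x \<in> carrier M" for r x
  proof -
    have "r \<odot>\<^bsub>M\<^esub> (\<ominus>\<^bsub>M\<^esub> x) = (\<ominus>\<^bsub>R\<^esub> \<one>\<^bsub>R\<^esub> \<otimes>\<^bsub>R\<^esub> r) \<odot>\<^bsub>M\<^esub> x"
      using that by (simp only: rsmult_assoc R.a_inv_closed R.one_closed minus_one_rsmult)
    also have "\<ominus>\<^bsub>R\<^esub> \<one>\<^bsub>R\<^esub> \<otimes>\<^bsub>R\<^esub> r = r \<otimes>\<^bsub>R\<^esub> \<ominus>\<^bsub>R\<^esub> \<one>\<^bsub>R\<^esub>"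
      using that by (simp add: R.l_minus R.r_minus)
    also have "(r \<otimes>\<^bsub>R\<^esub> \<ominus>\<^bsub>R\<^esub> \<one>\<^bsub>R\<^esub>) \<odot>\<^bsub>M\<^esub> x = \<ominus>\<^bsub>M\<^esub> (r \<odot>\<^bsub>M\<^esub> x)"
      using that by (simp only: rsmult_assoc R.a_inv_closed R.one_closed minus_one_rsmult rsmult_closed)
    finally show ?thesis .
  qed
  show ?thesis
    unfolding module_Hom_def
  proof (safe)
    fix x y assume xy: "x \<in> carrier A" "y \<in> carrier A"
    then have "f x \<in> carrier M" "f y \<in> carrier M" "g x \<in> carrier M" "g y \<in> carrier M"
      using assms Hom_closed by metis+
    then show "f (x \<oplus>\<^bsub>A\<^esub> y) \<ominus>\<^bsub>M\<^esub> g (x \<oplus>\<^bsub>A\<^esub> y) = f x \<ominus>\<^bsub>M\<^esub> g x \<oplus>\<^bsub>M\<^esub> (f y \<ominus>\<^bsub>M\<^esub> g y)"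
      using xy assms by (simp add: Hom_add a_minus_def M.minus_add M.a_ac)
  next
    fix r x assume rx: "r \<in> carrier R" "x \<in> carrier A"
    then have "f x \<in> carrier M" "g x \<in> carrier M"
      using assms Hom_closed by metis+
    then show "f (r \<odot>\<^bsub>A\<^esub> x) \<ominus>\<^bsub>M\<^esub> g (r \<odot>\<^bsub>A\<^esub> x) = r \<odot>\<^bsub>M\<^esub> (f x \<ominus>\<^bsub>M\<^esub> g x)"
      using rx assms by (simp add: Hom_smult a_minus_def minus rsmult_module_distr)
  qed (use assms in \<open>auto dest: Hom_closed\<close>)
qed

lemma submodule_vimage:
  assumes "right_module R A" "right_module R B" "f \<in> module_Hom R A B" "submodule K R B"
  shows "submodule {x \<in> carrier A. f x \<in> K} R A"
proof -
  interpret A: right_module R A by fact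
  interpret B: right_module R B by fact
  show ?thesis
    using assms Hom_zero[OF assms(1-3)]
    by (auto simp: A.submodule_iff B.submodule_iff Hom_add Hom_smult)
qed

lemma submodule_image:
  assumes "right_module R A" "right_module R B" "f \<in> module_Hom R A B" "submodule L R A"
  shows "submodule (f ` L) R B"
proof -
  interpret A: right_module R A by fact
  interpret B: right_module R B by fact
  have L: "L \<subseteq> carrier A" "\<zero>\<^bsub>A\<^esub> \<in> L" "\<And>x y. x \<in> L \<Longrightarrow> y \<in> L \<Longrightarrow> x \<oplus>\<^bsub>A\<^esub> y \<in> L"
    "\<And>a x. a \<in> carrier R \<Longrightarrow> x \<in> L \<Longrightarrow> a \<odot>\<^bsub>A\<^esub> x \<in> L"
    using assms(4) by (auto simp: A.submodule_iff)
  have "\<zero>\<^bsub>B\<^esub> \<in> f ` L"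
    using L(2) Hom_zero[OF assms(1-3)] by (metis imageI)
  moreover have "f x \<oplus>\<^bsub>B\<^esub> f y \<in> f ` L" if "x \<in> L" "y \<in> L" for x y
    using that L Hom_add[OF assms(3), of x y] by (metis imageI subsetD)
  moreover have "a \<odot>\<^bsub>B\<^esub> f x \<in> f ` L" if "a \<in> carrier R" "x \<in> L" for a x
    using that L Hom_smult[OF assms(3), of a x] by (metis imageI subsetD)
  ultimately show ?thesis
    using L Hom_closed[OF assms(3)] by (auto simp: B.submodule_iff)
qed

section \<open>Projections onto direct summands\<close>

text \<open>
  For a submodule \<open>P\<close>, these are the idempotent endomorphisms with image \<open>P\<close>. They encode \<open>P\<close> together with a choice
  of complement, namely the kernel.
\<close>

definition module_projection ::
    "('a, 'r) ring_scheme \<Rightarrow> ('a, 'b, 'm) module_scheme \<Rightarrow> 'b set \<Rightarrow> ('b \<Rightarrow> 'b) \<Rightarrow> bool"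
  where "module_projection R M P p \<longleftrightarrow>
    p \<in> module_Hom R M M \<and> (\<forall>x\<in>carrier M. p x \<in> P) \<and> (\<forall>x\<in>P. p x = x)"

context right_module
begin

lemma minus_add_cancel:
  "\<lbrakk>x \<in> carrier M; y \<in> carrier M\<rbrakk> \<Longrightarrow> y \<oplus>\<^bsub>M\<^esub> (x \<ominus>\<^bsub>M\<^esub> y) = x"
  by (simp add: a_minus_def M.a_lcomm[of y x] M.r_neg)

lemma minus_eq_zero_iff:
  assumes "x \<in> carrier M" "y \<in> carrier M"
  shows "x \<ominus>\<^bsub>M\<^esub> y = \<zero>\<^bsub>M\<^esub> \<longleftrightarrow> x = y"
proof
  assume "x \<ominus>\<^bsub>M\<^esub> y = \<zero>\<^bsub>M\<^esub>"
  then show "x = y"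
    using minus_add_cancel[OF assms] assms by simp
qed (use assms in \<open>simp add: a_minus_def M.r_neg\<close>)

lemma direct_summand_iff_projection:
  "direct_summand D R M \<longleftrightarrow> submodule D R M \<and> (\<exists>p. module_projection R M D p)"
proof
  assume "direct_summand D R M"
  then obtain D' where D: "submodule D R M" and D': "submodule D' R M"
    and sum: "D <+>\<^bsub>M\<^esub> D' = carrier M" and int: "D \<inter> D' = {\<zero>\<^bsub>M\<^esub>}"
    by (auto simp: direct_summand_def)
  have cD: "D \<subseteq> carrier M" and cD': "D' \<subseteq> carrier M"
    and zD: "\<zero>\<^bsub>M\<^esub> \<in> D" and zD': "\<zero>\<^bsub>M\<^esub> \<in> D'"
    using D D' submodule_iff by auto
  define P where "P x d \<longleftrightarrow> d \<in> D \<and> (\<exists>d'\<in>D'. x = d \<oplus>\<^bsub>M\<^esub> d')" for x d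
  have ex: "\<exists>d. P x d" if "x \<in> carrier M" for x
    using that sum unfolding P_def set_add_def' by blast
  have uniq: "d = e" if P: "P x d" "P x e" for x d e
  proof -
    obtain d' e' where de: "d \<in> D" "e \<in> D" "d' \<in> D'" "e' \<in> D'"
      and eq: "x = d \<oplus>\<^bsub>M\<^esub> d'" "x = e \<oplus>\<^bsub>M\<^esub> e'"
      using P by (auto simp: P_def)
    then have c: "d \<in> carrier M" "e \<in> carrier M" "d' \<in> carrier M" "e' \<in> carrier M"
      using cD cD' by auto
    (* This element lies in both D and D', so it is zero. *)
    have "d \<ominus>\<^bsub>M\<^esub> e = e' \<ominus>\<^bsub>M\<^esub> d'"
    proof -
      have "d \<ominus>\<^bsub>M\<^esub> e = (d \<oplus>\<^bsub>M\<^esub> d') \<ominus>\<^bsub>M\<^esub> d' \<ominus>\<^bsub>M\<^esub> e"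
        using c by (simp add: a_minus_def M.a_assoc M.r_neg)
      also have "\<dots> = (e \<oplus>\<^bsub>M\<^esub> e') \<ominus>\<^bsub>M\<^esub> d' \<ominus>\<^bsub>M\<^esub> e"
        using eq by simp
      also have "\<dots> = e' \<ominus>\<^bsub>M\<^esub> d'"
        using c by (simp add: a_minus_def M.a_assoc M.r_neg M.r_neg2 M.a_lcomm[of _ e] M.a_comm[of _ "\<ominus>\<^bsub>M\<^esub> e"])
      finally show ?thesis .
    qed
    then have "d \<ominus>\<^bsub>M\<^esub> e \<in> D \<inter> D'"
      using de submodule_minus[OF D] submodule_minus[OF D'] by (metis IntI)
    then show ?thesis
      using int c minus_eq_zero_iff by auto
  qed
  define p where "p x = (THE d. P x d)" for x
  have P_p: "P x (p x)" if "x \<in> carrier M" for x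
    unfolding p_def using theI'[of "P x"] ex[OF that] uniq by blast
  have p_eq: "p x = d" if "P x d" for x d
    unfolding p_def using that uniq by blast
  have "module_projection R M D p"
    unfolding module_projection_def module_Hom_def
  proof (safe)
    fix x assume x: "x \<in> carrier M"
    show "p x \<in> D" "p x \<in> carrier M"
      using P_p[OF x] cD by (auto simp: P_def)
  next
    fix x y assume xy: "x \<in> carrier M" "y \<in> carrier M"
    obtain d' e' where de: "p x \<in> D" "p y \<in> D" "d' \<in> D'" "e' \<in> D'"
      and eq: "x = p x \<oplus>\<^bsub>M\<^esub> d'" "y = p y \<oplus>\<^bsub>M\<^esub> e'"
      using P_p[OF xy(1)] P_p[OF xy(2)] by (auto simp: P_def)
    then have c: "p x \<in> carrier M" "p y \<in> carrier M" "d' \<in> carrier M" "e' \<in> carrier M"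
      using cD cD' by auto
    have "x \<oplus>\<^bsub>M\<^esub> y = (p x \<oplus>\<^bsub>M\<^esub> d') \<oplus>\<^bsub>M\<^esub> (p y \<oplus>\<^bsub>M\<^esub> e')"
      using eq by simp
    also have "\<dots> = (p x \<oplus>\<^bsub>M\<^esub> p y) \<oplus>\<^bsub>M\<^esub> (d' \<oplus>\<^bsub>M\<^esub> e')"
      using c by (simp add: M.a_ac)
    finally have "P (x \<oplus>\<^bsub>M\<^esub> y) (p x \<oplus>\<^bsub>M\<^esub> p y)"
      using de D D' by (auto simp: P_def submodule_iff)
    then show "p (x \<oplus>\<^bsub>M\<^esub> y) = p x \<oplus>\<^bsub>M\<^esub> p y"
      by (rule p_eq)
  next
    fix r x assume rx: "r \<in> carrier R" "x \<in> carrier M"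
    obtain d' where de: "p x \<in> D" "d' \<in> D'" and eq: "x = p x \<oplus>\<^bsub>M\<^esub> d'"
      using P_p[OF rx(2)] by (auto simp: P_def)
    then have c: "p x \<in> carrier M" "d' \<in> carrier M"
      using cD cD' by auto
    have "r \<odot>\<^bsub>M\<^esub> x = r \<odot>\<^bsub>M\<^esub> (p x \<oplus>\<^bsub>M\<^esub> d')"
      using eq by simp
    also have "\<dots> = r \<odot>\<^bsub>M\<^esub> p x \<oplus>\<^bsub>M\<^esub> r \<odot>\<^bsub>M\<^esub> d'"
      using c rx by (simp add: rsmult_module_distr)
    finally have "P (r \<odot>\<^bsub>M\<^esub> x) (r \<odot>\<^bsub>M\<^esub> p x)"
      using de D D' rx by (auto simp: P_def submodule_iff)
    then show "p (r \<odot>\<^bsub>M\<^esub> x) = r \<odot>\<^bsub>M\<^esub> p x"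
      by (rule p_eq)
  next
    fix x assume x: "x \<in> D"
    then have "x = x \<oplus>\<^bsub>M\<^esub> \<zero>\<^bsub>M\<^esub>"
      using cD by auto
    then have "P x x"
      using x zD' by (auto simp: P_def)
    then show "p x = x"
      by (rule p_eq)
  qed
  then show "submodule D R M \<and> (\<exists>p. module_projection R M D p)"
    using D by blast
next
  assume "submodule D R M \<and> (\<exists>p. module_projection R M D p)"
  then obtain p where D: "submodule D R M" and p: "module_projection R M D p"
    by blast
  have hom: "p \<in> module_Hom R M M" and im: "\<And>x. x \<in> carrier M \<Longrightarrow> p x \<in> D"
    and fix_D: "\<And>x. x \<in> D \<Longrightarrow> p x = x" and cD: "D \<subseteq> carrier M" and zD: "\<zero>\<^bsub>M\<^esub> \<in> D"
    using p D submodule_iff by (auto simp: module_projection_def)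
  define D' where "D' = {x \<in> carrier M. p x \<in> {\<zero>\<^bsub>M\<^esub>}}"
  have D': "submodule D' R M"
    unfolding D'_def
    by (rule submodule_vimage[OF right_module_axioms right_module_axioms hom zero_submodule])
  have "x \<in> D <+>\<^bsub>M\<^esub> D'" if x: "x \<in> carrier M" for x
  proof -
    have px: "p x \<in> D" "p x \<in> carrier M"
      using im[OF x] cD by auto
    then have "p (x \<ominus>\<^bsub>M\<^esub> p x) = \<zero>\<^bsub>M\<^esub>"
      using x fix_D minus_eq_zero_iff
      by (simp add: Hom_minus[OF right_module_axioms right_module_axioms hom])
    then have "x \<ominus>\<^bsub>M\<^esub> p x \<in> D'"
      using x px by (simp add: D'_def)
    then show ?thesis
      using px minus_add_cancel[OF x px(2)] unfolding set_add_def' by fastforce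
  qed
  moreover have "D <+>\<^bsub>M\<^esub> D' \<subseteq> carrier M"
    using cD unfolding set_add_def' D'_def by auto
  moreover have "D \<inter> D' = {\<zero>\<^bsub>M\<^esub>}"
    using fix_D zD by (auto simp: D'_def)
  ultimately show "direct_summand D R M"
    using D D' unfolding direct_summand_def by blast
qed

lemma direct_summand_submodule: "direct_summand D R M \<Longrightarrow> submodule D R M"
  by (simp add: direct_summand_def)

lemma direct_summand_carrier: "direct_summand (carrier M) R M"
proof -
  have "module_projection R M (carrier M) (\<lambda>x. x)"
    by (auto simp: module_projection_def module_Hom_def)
  then show ?thesis
    using carrier_submodule direct_summand_iff_projection by blast
qed

text \<open>If \<open>e\<close> is idempotent, so is \<open>1 - e\<close>, and its image is the kernel of \<open>e\<close>.\<close>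

lemma projection_kernel_complement:
  assumes "submodule C R M" "module_projection R M C e"
  shows "submodule {x \<in> carrier M. e x = \<zero>\<^bsub>M\<^esub>} R M"
    and "module_projection R M {x \<in> carrier M. e x = \<zero>\<^bsub>M\<^esub>} (\<lambda>x. x \<ominus>\<^bsub>M\<^esub> e x)"
proof -
  have e: "e \<in> module_Hom R M M" and im: "\<And>x. x \<in> carrier M \<Longrightarrow> e x \<in> C"
    and id: "\<And>x. x \<in> C \<Longrightarrow> e x = x" and C: "C \<subseteq> carrier M"
    using assms submodule_iff by (auto simp: module_projection_def)
  show "submodule {x \<in> carrier M. e x = \<zero>\<^bsub>M\<^esub>} R M"
    using submodule_vimage[OF right_module_axioms right_module_axioms e zero_submodule] by simp
  have "(\<lambda>x. x) \<in> module_Hom R M M"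
    by (auto simp: module_Hom_def)
  then have "(\<lambda>x. x \<ominus>\<^bsub>M\<^esub> e x) \<in> module_Hom R M M"
    using Hom_diff[OF right_module_axioms _ e] by blast
  moreover have "e (x \<ominus>\<^bsub>M\<^esub> e x) = \<zero>\<^bsub>M\<^esub>" if x: "x \<in> carrier M" for x
  proof -
    have "e x \<in> carrier M"
      using im[OF x] C by blast
    then have "e (x \<ominus>\<^bsub>M\<^esub> e x) = e x \<ominus>\<^bsub>M\<^esub> e (e x)"
      using x by (simp add: Hom_minus[OF right_module_axioms right_module_axioms e])
    also have "\<dots> = \<zero>\<^bsub>M\<^esub>"
      using im[OF x] id \<open>e x \<in> carrier M\<close> minus_eq_zero_iff by simp
    finally show ?thesis .
  qed
  moreover have "x \<ominus>\<^bsub>M\<^esub> \<zero>\<^bsub>M\<^esub> = x" if "x \<in> carrier M" for x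
    using that by (simp add: a_minus_def)
  ultimately show "module_projection R M {x \<in> carrier M. e x = \<zero>\<^bsub>M\<^esub>} (\<lambda>x. x \<ominus>\<^bsub>M\<^esub> e x)"
    using Hom_closed by (auto simp: module_projection_def)
qed

end

section \<open>Essential submodules\<close>

context right_module
begin

lemma essential_restrict_iff:
  assumes "submodule D R M"
  shows "essential_submodule K R (M\<lparr>carrier := D\<rparr>) \<longleftrightarrow> submodule K R M \<and> K \<subseteq> D \<and>
    (\<forall>L. submodule L R M \<and> L \<subseteq> D \<and> L \<noteq> {\<zero>\<^bsub>M\<^esub>} \<longrightarrow> K \<inter> L \<noteq> {\<zero>\<^bsub>M\<^esub>})"
  using submodule_restrict_iff[OF assms] by (auto simp: essential_submodule_def)

lemma essential_restrictD:
  assumes "submodule D R M" "essential_submodule K R (M\<lparr>carrier := D\<rparr>)"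
  shows "submodule K R M" "K \<subseteq> D"
    and "\<And>L. \<lbrakk>submodule L R M; L \<subseteq> D; L \<noteq> {\<zero>\<^bsub>M\<^esub>}\<rbrakk> \<Longrightarrow> K \<inter> L \<noteq> {\<zero>\<^bsub>M\<^esub>}"
  using assms(2) unfolding essential_restrict_iff[OF assms(1)] by auto

lemma essential_carrier: "essential_submodule (carrier M) R M"
  using carrier_submodule submodule_iff by (auto simp: essential_submodule_def Int_absorb1)

lemma essential_mono:
  assumes "essential_submodule K R M" "K \<subseteq> K'" "submodule K' R M"
  shows "essential_submodule K' R M"
  unfolding essential_submodule_def
proof (intro conjI allI impI assms(3))
  fix L assume L: "submodule L R M \<and> L \<noteq> {\<zero>\<^bsub>M\<^esub>}"
  then have "K \<inter> L \<noteq> {\<zero>\<^bsub>M\<^esub>}" "\<zero>\<^bsub>M\<^esub> \<in> K \<inter> L"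
    using assms(1) by (auto simp: essential_submodule_def submodule_iff)
  then show "K' \<inter> L \<noteq> {\<zero>\<^bsub>M\<^esub>}"
    using assms(2) by blast
qed

text \<open>
  A nonzero \<open>L \<subseteq> D'\<close> meets \<open>K'\<close> in a nonzero submodule of \<open>D\<close>, and this in turn meets \<open>K\<close>.
\<close>

lemma essential_Int_restrict:
  assumes D: "submodule D R M" and D': "submodule D' R M" "D' \<subseteq> D"
    and K: "essential_submodule K R (M\<lparr>carrier := D\<rparr>)"
    and K': "essential_submodule K' R (M\<lparr>carrier := D'\<rparr>)"
  shows "essential_submodule (K \<inter> K') R (M\<lparr>carrier := D'\<rparr>)"
  unfolding essential_restrict_iff[OF D'(1)]
proof (intro conjI allI impI)
  have sK: "submodule K R M" and sK': "submodule K' R M" and "K' \<subseteq> D'"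
    using essential_restrictD[OF D K] essential_restrictD[OF D'(1) K'] by simp_all
  then show "submodule (K \<inter> K') R M" "K \<inter> K' \<subseteq> D'"
    using submodule_Int by auto
  fix L assume L: "submodule L R M \<and> L \<subseteq> D' \<and> L \<noteq> {\<zero>\<^bsub>M\<^esub>}"
  then have "submodule (K' \<inter> L) R M" "K' \<inter> L \<subseteq> D" "K' \<inter> L \<noteq> {\<zero>\<^bsub>M\<^esub>}"
    using D'(2) sK' submodule_Int essential_restrictD(3)[OF D'(1) K', of L] by auto
  then have "K \<inter> (K' \<inter> L) \<noteq> {\<zero>\<^bsub>M\<^esub>}"
    by (rule essential_restrictD(3)[OF D K])
  then show "K \<inter> K' \<inter> L \<noteq> {\<zero>\<^bsub>M\<^esub>}"
    by (simp add: Int_assoc)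
qed

lemma essential_Int:
  assumes "essential_submodule K R M" "essential_submodule K' R M"
  shows "essential_submodule (K \<inter> K') R M"
  using essential_Int_restrict[OF carrier_submodule carrier_submodule, of K K'] assms by simp

end

text \<open>
  A nonzero submodule of \<open>A\<close> that \<open>f\<close> kills is contained in the preimage. Any other one has a
  nonzero image, which meets \<open>K\<close> outside zero.
\<close>

lemma essential_vimage:
  assumes A: "right_module R A" and B: "right_module R B" and f: "f \<in> module_Hom R A B"
    and K: "essential_submodule K R B"
  shows "essential_submodule {x \<in> carrier A. f x \<in> K} R A"
  unfolding essential_submodule_def
proof (intro conjI allI impI)
  interpret A: right_module R A by fact
  interpret B: right_module R B by fact
  have sK: "submodule K R B"
    using K by (simp add: essential_submodule_def)
  then show "submodule {x \<in> carrier A. f x \<in> K} R A"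
    by (rule submodule_vimage[OF A B f])
  fix L assume L: "submodule L R A \<and> L \<noteq> {\<zero>\<^bsub>A\<^esub>}"
  then have sL: "submodule L R A" and cL: "L \<subseteq> carrier A" and zL: "\<zero>\<^bsub>A\<^esub> \<in> L"
    using A.submodule_iff by auto
  have zK: "\<zero>\<^bsub>B\<^esub> \<in> K"
    using sK B.submodule_iff by blast
  show "{x \<in> carrier A. f x \<in> K} \<inter> L \<noteq> {\<zero>\<^bsub>A\<^esub>}"
  proof (cases "f ` L = {\<zero>\<^bsub>B\<^esub>}")
    case True
    then have "f x = \<zero>\<^bsub>B\<^esub>" if "x \<in> L" for x
      using imageI[OF that, of f] by simp
    then have "{x \<in> carrier A. f x \<in> K} \<inter> L = L"
      using cL zK by auto
    then show ?thesis
      using L by simp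
  next
    case False
    have fL: "submodule (f ` L) R B"
      by (rule submodule_image[OF A B f sL])
    then have "K \<inter> f ` L \<noteq> {\<zero>\<^bsub>B\<^esub>}" "\<zero>\<^bsub>B\<^esub> \<in> K \<inter> f ` L"
      using K False zK B.submodule_iff by (auto simp: essential_submodule_def)
    then obtain x where x: "x \<in> L" "f x \<in> K" "f x \<noteq> \<zero>\<^bsub>B\<^esub>"
      by blast
    then have "x \<noteq> \<zero>\<^bsub>A\<^esub>"
      using Hom_zero[OF A B f] by blast
    then show ?thesis
      using x cL by blast
  qed
qed

section \<open>Submodules that are essential in a direct summand\<close>

definition essential_in_summand ::
    "'b set \<Rightarrow> ('a, 'r) ring_scheme \<Rightarrow> ('a, 'b, 'm) module_scheme \<Rightarrow> bool"
  where "essential_in_summand K R M \<longleftrightarrow>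
    (\<exists>D. direct_summand D R M \<and> essential_submodule K R (M\<lparr>carrier := D\<rparr>))"

context right_module
begin

text \<open>
  With \<open>C\<close> the kernel of \<open>p\<close>, the preimage of \<open>K\<close> is \<open>K \<oplus> C\<close>. As \<open>D\<close> contains \<open>C\<close>, it is stable
  under \<open>p\<close>, so \<open>D = C \<oplus> (D \<inter> P)\<close>, and \<open>p \<circ> q\<close> projects onto \<open>D \<inter> P\<close> when \<open>q\<close> projects onto \<open>D\<close>.
  On \<open>P\<close> the map \<open>p\<close> is the identity, so a submodule of \<open>D \<inter> P\<close> meets \<open>K\<close> exactly where it meets
  the preimage of \<open>K\<close>.
\<close>

lemma essential_in_summand_if_vimage:
  assumes P: "submodule P R M" and p: "module_projection R M P p"
    and K: "submodule K R M" "K \<subseteq> P"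
    and D: "direct_summand D R M"
    and ess: "essential_submodule {x \<in> carrier M. p x \<in> K} R (M\<lparr>carrier := D\<rparr>)"
  shows "direct_summand (D \<inter> P) R M \<and> essential_submodule K R (M\<lparr>carrier := D \<inter> P\<rparr>)"
proof
  obtain q where q: "module_projection R M D q" and sD: "submodule D R M"
    using D direct_summand_iff_projection by blast
  have hom: "p \<in> module_Hom R M M" "q \<in> module_Hom R M M"
    and p_im: "\<And>x. x \<in> carrier M \<Longrightarrow> p x \<in> P" and p_id: "\<And>x. x \<in> P \<Longrightarrow> p x = x"
    and q_im: "\<And>x. x \<in> carrier M \<Longrightarrow> q x \<in> D" and q_id: "\<And>x. x \<in> D \<Longrightarrow> q x = x"
    using p q by (auto simp: module_projection_def)
  have cP: "P \<subseteq> carrier M" and cD: "D \<subseteq> carrier M" and zK: "\<zero>\<^bsub>M\<^esub> \<in> K"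
    using P sD K by (simp_all add: submodule_iff)
  have vD: "{x \<in> carrier M. p x \<in> K} \<subseteq> D"
    by (rule essential_restrictD(2)[OF sD ess])
  have DP: "submodule (D \<inter> P) R M"
    by (rule submodule_Int[OF sD P])
  have p_D: "p y \<in> D" if y: "y \<in> D" for y
  proof -
    have c: "y \<in> carrier M" "p y \<in> carrier M" "p y \<in> P"
      using y cD cP p_im by blast+
    have "p (y \<ominus>\<^bsub>M\<^esub> p y) = p y \<ominus>\<^bsub>M\<^esub> p (p y)"
      using c by (simp add: Hom_minus[OF right_module_axioms right_module_axioms hom(1)])
    also have "\<dots> = \<zero>\<^bsub>M\<^esub>"
      using c p_id minus_eq_zero_iff by simp
    (* The difference is in the kernel of p, hence in the preimage of K. *)
    finally have "y \<ominus>\<^bsub>M\<^esub> p y \<in> D"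
      using c zK vD by auto
    then have "y \<ominus>\<^bsub>M\<^esub> (y \<ominus>\<^bsub>M\<^esub> p y) \<in> D"
      using submodule_minus[OF sD y] by blast
    also have "y \<ominus>\<^bsub>M\<^esub> (y \<ominus>\<^bsub>M\<^esub> p y) = p y"
      using c by (simp add: a_minus_def M.minus_add M.r_neg2)
    finally show ?thesis .
  qed
  have "p (q x) \<in> D \<inter> P" if "x \<in> carrier M" for x
    using q_im[OF that] p_D p_im cD by auto
  then have "module_projection R M (D \<inter> P) (\<lambda>x. p (q x))"
    using Hom_compose[OF hom(2,1)] q_id p_id
    by (simp add: module_projection_def)
  then show "direct_summand (D \<inter> P) R M"
    using DP direct_summand_iff_projection by blast
  show "essential_submodule K R (M\<lparr>carrier := D \<inter> P\<rparr>)"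
    unfolding essential_restrict_iff[OF DP]
  proof (intro conjI allI impI K)
    show "K \<subseteq> D \<inter> P"
      using subsetD[OF K(2)] subsetD[OF cP] p_id by (auto intro!: subsetD[OF vD])
    fix L assume L: "submodule L R M \<and> L \<subseteq> D \<inter> P \<and> L \<noteq> {\<zero>\<^bsub>M\<^esub>}"
    then have "{x \<in> carrier M. p x \<in> K} \<inter> L \<noteq> {\<zero>\<^bsub>M\<^esub>}"
      using essential_restrictD(3)[OF sD ess, of L] by simp
    moreover have "{x \<in> carrier M. p x \<in> K} \<inter> L = K \<inter> L"
      using L p_id cP by auto
    ultimately show "K \<inter> L \<noteq> {\<zero>\<^bsub>M\<^esub>}"
      by simp
  qed
qed

end

text \<open>
  Induction on the number of kernels. Let the intersection of the earlier ones be essential in the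
  summand \<open>D\<close>, with projection \<open>p\<close>. The hypothesis cannot be applied to the restriction of \<open>f j\<close>
  to \<open>D\<close>, whose domain is not \<open>A\<close>, but it applies to \<open>f j \<circ> p\<close>. The kernel of that map is the preimage
  under \<open>p\<close> of \<open>ker (f j) \<inter> D\<close>, and so \<open>ker (f j) \<inter> D\<close> is essential in a summand contained in \<open>D\<close>.
\<close>

lemma relatively_CS_Rickart_Int_kernels:
  assumes A: "right_module R A" and "finite J"
    and "\<And>j. j \<in> J \<Longrightarrow> right_module R (B j)"
    and "\<And>j. j \<in> J \<Longrightarrow> f j \<in> module_Hom R A (B j)"
    and "\<And>j. j \<in> J \<Longrightarrow> relatively_CS_Rickart R A (B j)"
  shows "essential_in_summand {x \<in> carrier A. \<forall>j\<in>J. f j x = \<zero>\<^bsub>B j\<^esub>} R A"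
  using assms(2-)
proof (induction J rule: finite_induct)
  interpret A: right_module R A by fact
  case empty
  show ?case
    using A.direct_summand_carrier A.essential_carrier by (auto simp: essential_in_summand_def)
next
  interpret A: right_module R A by fact
  case (insert j J)
  interpret B: right_module R "B j"
    by (simp add: insert.prems)
  let ?K = "{x \<in> carrier A. \<forall>j\<in>J. f j x = \<zero>\<^bsub>B j\<^esub>}"
  have f: "f j \<in> module_Hom R A (B j)"
    by (simp add: insert.prems)
  obtain D where D: "direct_summand D R A" and ess: "essential_submodule ?K R (A\<lparr>carrier := D\<rparr>)"
    using insert.IH insert.prems by (auto simp: essential_in_summand_def)
  then obtain p where p: "module_projection R A D p" and sD: "submodule D R A"
    using A.direct_summand_iff_projection by blast
  have hom: "p \<in> module_Hom R A A" and p_im: "\<And>x. x \<in> carrier A \<Longrightarrow> p x \<in> D"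
    and cD: "D \<subseteq> carrier A"
    using p sD A.submodule_iff by (auto simp: module_projection_def)
  define L where "L = {x \<in> carrier A. f j x \<in> {\<zero>\<^bsub>B j\<^esub>}} \<inter> D"
  have sL: "submodule L R A"
    unfolding L_def
    by (intro A.submodule_Int submodule_vimage[OF A B.right_module_axioms f] B.zero_submodule sD)
  have "(\<lambda>x. f j (p x)) \<in> module_Hom R A (B j)"
    by (rule Hom_compose[OF hom f])
  then obtain E where E: "direct_summand E R A"
    and "essential_submodule (a_kernel A (B j) (\<lambda>x. f j (p x))) R (A\<lparr>carrier := E\<rparr>)"
    using insert.prems(3)[of j] unfolding relatively_CS_Rickart_def by blast
  moreover have "a_kernel A (B j) (\<lambda>x. f j (p x)) = {x \<in> carrier A. p x \<in> L}"
    using p_im cD by (auto simp: a_kernel_def' L_def)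
  ultimately have ED: "direct_summand (E \<inter> D) R A"
    and essL: "essential_submodule L R (A\<lparr>carrier := E \<inter> D\<rparr>)"
    using A.essential_in_summand_if_vimage[OF sD p sL _ E] by (auto simp: L_def)
  have "essential_submodule (?K \<inter> L) R (A\<lparr>carrier := E \<inter> D\<rparr>)"
    by (rule A.essential_Int_restrict[OF sD A.direct_summand_submodule[OF ED] _ ess essL]) blast
  moreover have "?K \<subseteq> D"
    by (rule A.essential_restrictD(2)[OF sD ess])
  then have "?K \<inter> L = {x \<in> carrier A. \<forall>j\<in>insert j J. f j x = \<zero>\<^bsub>B j\<^esub>}"
    by (auto simp: L_def)
  ultimately show ?case
    using ED by (auto simp: essential_in_summand_def)
qed

section \<open>The condition on submodules isomorphic to direct summands\<close>

text \<open>
  If \<open>s\<close> inverts \<open>\<phi>\<close> on \<open>\<phi> ` C\<close> and \<open>g\<close> projects onto \<open>\<phi> ` C\<close>, which is a summand by the \<open>C2\<close>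
  condition, then \<open>e = s \<circ> g \<circ> \<phi>\<close> fixes \<open>C\<close> and factors through \<open>\<phi>\<close>. In terms of complements: the
  kernel of \<open>e\<close> is a complement of \<open>C\<close> that contains the kernel of \<open>\<phi>\<close>.
\<close>

lemma (in right_module) C2_projection_vanishing_on_kernel:
  assumes C2: "C2_module R M" and \<phi>: "\<phi> \<in> module_Hom R M M"
    and C: "direct_summand C R M"
    and inj: "\<And>x. x \<in> C \<Longrightarrow> \<phi> x = \<zero>\<^bsub>M\<^esub> \<Longrightarrow> x = \<zero>\<^bsub>M\<^esub>"
  obtains e where "module_projection R M C e" "\<And>x. x \<in> carrier M \<Longrightarrow> \<phi> x = \<zero>\<^bsub>M\<^esub> \<Longrightarrow> e x = \<zero>\<^bsub>M\<^esub>"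
proof -
  have sC: "submodule C R M"
    by (rule direct_summand_submodule[OF C])
  then have cC: "C \<subseteq> carrier M" and zC: "\<zero>\<^bsub>M\<^esub> \<in> C"
    and addC: "\<And>x y. x \<in> C \<Longrightarrow> y \<in> C \<Longrightarrow> x \<oplus>\<^bsub>M\<^esub> y \<in> C"
    and smultC: "\<And>r x. r \<in> carrier R \<Longrightarrow> x \<in> C \<Longrightarrow> r \<odot>\<^bsub>M\<^esub> x \<in> C"
    using submodule_iff by auto
  have sI: "submodule (\<phi> ` C) R M"
    by (rule submodule_image[OF right_module_axioms right_module_axioms \<phi> sC])
  have inj_on: "inj_on \<phi> C"
  proof (rule inj_onI)
    fix x y assume xy: "x \<in> C" "y \<in> C" "\<phi> x = \<phi> y"
    then have c: "x \<in> carrier M" "y \<in> carrier M"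
      using cC by auto
    then have "\<phi> (x \<ominus>\<^bsub>M\<^esub> y) = \<zero>\<^bsub>M\<^esub>"
      using xy Hom_closed[OF \<phi>] minus_eq_zero_iff
      by (simp add: Hom_minus[OF right_module_axioms right_module_axioms \<phi>])
    then have "x \<ominus>\<^bsub>M\<^esub> y = \<zero>\<^bsub>M\<^esub>"
      by (rule inj[OF submodule_minus[OF sC xy(1,2)]])
    then show "x = y"
      using c minus_eq_zero_iff by blast
  qed
  define s where "s = the_inv_into C \<phi>"
  have s_\<phi>: "s (\<phi> x) = x" if "x \<in> C" for x
    unfolding s_def by (rule the_inv_into_f_f[OF inj_on that])
  have s_hom: "s \<in> module_Hom R (M\<lparr>carrier := \<phi> ` C\<rparr>) (M\<lparr>carrier := C\<rparr>)"
    unfolding module_Hom_def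
  proof (safe, simp_all, safe)
    fix x assume "x \<in> C"
    then show "s (\<phi> x) \<in> C"
      by (simp add: s_\<phi>)
  next
    fix x y assume xy: "x \<in> C" "y \<in> C"
    then have "\<phi> x \<oplus>\<^bsub>M\<^esub> \<phi> y = \<phi> (x \<oplus>\<^bsub>M\<^esub> y)"
      using Hom_add[OF \<phi> subsetD[OF cC] subsetD[OF cC]] by simp
    then show "s (\<phi> x \<oplus>\<^bsub>M\<^esub> \<phi> y) = s (\<phi> x) \<oplus>\<^bsub>M\<^esub> s (\<phi> y)"
      using xy addC by (simp add: s_\<phi>)
  next
    fix r x assume rx: "r \<in> carrier R" "x \<in> C"
    then have "r \<odot>\<^bsub>M\<^esub> \<phi> x = \<phi> (r \<odot>\<^bsub>M\<^esub> x)"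
      using Hom_smult[OF \<phi> _ subsetD[OF cC]] by simp
    then show "s (r \<odot>\<^bsub>M\<^esub> \<phi> x) = r \<odot>\<^bsub>M\<^esub> s (\<phi> x)"
      using rx smultC by (simp add: s_\<phi>)
  qed
  moreover have "bij_betw s (\<phi> ` C) C"
    unfolding s_def using inj_on by (simp add: bij_betw_imageI bij_betw_the_inv_into)
  ultimately have "module_isomorphic R (M\<lparr>carrier := \<phi> ` C\<rparr>) (M\<lparr>carrier := C\<rparr>)"
    by (auto simp: module_isomorphic_def)
  then have "direct_summand (\<phi> ` C) R M"
    using C2 C sI unfolding C2_module_def by blast
  then obtain g where g: "module_projection R M (\<phi> ` C) g"
    using direct_summand_iff_projection by blast
  then have g_hom: "g \<in> module_Hom R M M" and g_im: "\<And>x. x \<in> carrier M \<Longrightarrow> g x \<in> \<phi> ` C"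
    and g_id: "\<And>x. x \<in> C \<Longrightarrow> g (\<phi> x) = \<phi> x"
    by (auto simp: module_projection_def)
  define e where "e x = s (g (\<phi> x))" for x
  have "g \<in> module_Hom R M (M\<lparr>carrier := \<phi> ` C\<rparr>)"
    using g_hom g_im by (auto simp: module_Hom_def)
  then have "(\<lambda>x. s (g x)) \<in> module_Hom R M (M\<lparr>carrier := C\<rparr>)"
    using s_hom by (rule Hom_compose)
  then have "e \<in> module_Hom R M (M\<lparr>carrier := C\<rparr>)"
    unfolding e_def by (rule Hom_compose[OF \<phi>])
  then have "module_projection R M C e"
    using cC s_\<phi> g_id by (auto simp: module_projection_def module_Hom_def e_def)
  moreover have "e x = \<zero>\<^bsub>M\<^esub>" if "x \<in> carrier M" "\<phi> x = \<zero>\<^bsub>M\<^esub>" for x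
  proof -
    have "\<phi> \<zero>\<^bsub>M\<^esub> = \<zero>\<^bsub>M\<^esub>" "g \<zero>\<^bsub>M\<^esub> = \<zero>\<^bsub>M\<^esub>"
      using Hom_zero[OF right_module_axioms right_module_axioms] \<phi> g_hom by auto
    then show ?thesis
      using that s_\<phi>[OF zC] by (simp add: e_def)
  qed
  ultimately show thesis
    by (rule that)
qed

section \<open>Finite direct sums\<close>

context right_module
begin

lemma finsum_rsmult:
  assumes "finite I" "f \<in> I \<rightarrow> carrier M" "r \<in> carrier R"
  shows "(\<Oplus>\<^bsub>M\<^esub>i\<in>I. r \<odot>\<^bsub>M\<^esub> f i) = r \<odot>\<^bsub>M\<^esub> (\<Oplus>\<^bsub>M\<^esub>i\<in>I. f i)"
  using assms
  by (induction I rule: finite_induct)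
    (simp_all add: rsmult_zero M.finsum_insert rsmult_module_distr Pi_iff)

lemma submodule_finsum:
  assumes "submodule H R M" "finite I" "f \<in> I \<rightarrow> H"
  shows "(\<Oplus>\<^bsub>M\<^esub>i\<in>I. f i) \<in> H"
  using assms(2,3)
proof (induction I rule: finite_induct)
  case (insert i I)
  then have "f \<in> I \<rightarrow> carrier M" "f i \<in> carrier M"
    using assms(1) submodule_iff by auto
  then show ?case
    using insert assms(1) submodule_iff by (auto simp: M.finsum_insert)
qed (use assms(1) submodule_iff in simp)

lemma finite_direct_sum_projections:
  assumes "finite_direct_sum R M I N"
  obtains \<pi> where "\<And>i. i \<in> I \<Longrightarrow> module_projection R M (N i) (\<pi> i)"
    "\<And>x. x \<in> carrier M \<Longrightarrow> x = (\<Oplus>\<^bsub>M\<^esub>i\<in>I. \<pi> i x)"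
proof -
  have fin: "finite I" and N: "\<And>i. i \<in> I \<Longrightarrow> submodule (N i) R M"
    and ex1: "\<And>x. x \<in> carrier M \<Longrightarrow> \<exists>!f. f \<in> Pi\<^sub>E I N \<and> x = (\<Oplus>\<^bsub>M\<^esub>i\<in>I. f i)"
    using assms by (auto simp: finite_direct_sum_def)
  have N_carrier: "\<And>i x. i \<in> I \<Longrightarrow> x \<in> N i \<Longrightarrow> x \<in> carrier M"
    and N_zero: "\<And>i. i \<in> I \<Longrightarrow> \<zero>\<^bsub>M\<^esub> \<in> N i"
    and N_add: "\<And>i x y. i \<in> I \<Longrightarrow> x \<in> N i \<Longrightarrow> y \<in> N i \<Longrightarrow> x \<oplus>\<^bsub>M\<^esub> y \<in> N i"
    and N_smult: "\<And>i r x. i \<in> I \<Longrightarrow> r \<in> carrier R \<Longrightarrow> x \<in> N i \<Longrightarrow> r \<odot>\<^bsub>M\<^esub> x \<in> N i"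
    using N unfolding submodule_iff by (simp_all add: subset_iff)
  define \<rho> where "\<rho> x = (THE f. f \<in> Pi\<^sub>E I N \<and> x = (\<Oplus>\<^bsub>M\<^esub>i\<in>I. f i))" for x
  have \<rho>: "\<rho> x \<in> Pi\<^sub>E I N" "x = (\<Oplus>\<^bsub>M\<^esub>i\<in>I. \<rho> x i)" if "x \<in> carrier M" for x
    using theI'[OF ex1[OF that]] unfolding \<rho>_def by blast+
  have \<rho>_N: "\<rho> x i \<in> N i" if "x \<in> carrier M" "i \<in> I" for x i
    using \<rho>(1)[OF that(1)] that(2) by auto
  have \<rho>_eq: "\<rho> x i = f i"
    if f: "\<And>i. i \<in> I \<Longrightarrow> f i \<in> N i" and x: "x = (\<Oplus>\<^bsub>M\<^esub>i\<in>I. f i)" and i: "i \<in> I" for x f i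
  proof -
    have c: "f \<in> I \<rightarrow> carrier M"
      using f N_carrier by auto
    then have "x \<in> carrier M"
      using x by simp
    moreover have "restrict f I \<in> Pi\<^sub>E I N"
      using f by auto
    moreover have "(\<Oplus>\<^bsub>M\<^esub>i\<in>I. restrict f I i) = (\<Oplus>\<^bsub>M\<^esub>i\<in>I. f i)"
      by (rule M.finsum_cong') (use c in auto)
    ultimately have "\<rho> x = restrict f I"
      using \<rho> ex1 x by metis
    then show ?thesis
      using i by simp
  qed
  have "module_projection R M (N i) (\<lambda>x. \<rho> x i)" if i: "i \<in> I" for i
    unfolding module_projection_def module_Hom_def
  proof (safe)
    fix x assume "x \<in> carrier M"
    then show "\<rho> x i \<in> N i" "\<rho> x i \<in> carrier M"
      using \<rho>_N i N_carrier by auto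
  next
    fix x y assume xy: "x \<in> carrier M" "y \<in> carrier M"
    have c: "\<rho> x \<in> I \<rightarrow> carrier M" "\<rho> y \<in> I \<rightarrow> carrier M"
      using \<rho>_N xy N_carrier by auto
    have "x \<oplus>\<^bsub>M\<^esub> y = (\<Oplus>\<^bsub>M\<^esub>i\<in>I. \<rho> x i) \<oplus>\<^bsub>M\<^esub> (\<Oplus>\<^bsub>M\<^esub>i\<in>I. \<rho> y i)"
      using \<rho>(2)[OF xy(1)] \<rho>(2)[OF xy(2)] by simp
    also have "\<dots> = (\<Oplus>\<^bsub>M\<^esub>i\<in>I. \<rho> x i \<oplus>\<^bsub>M\<^esub> \<rho> y i)"
      using M.finsum_addf[OF c] by simp
    finally show "\<rho> (x \<oplus>\<^bsub>M\<^esub> y) i = \<rho> x i \<oplus>\<^bsub>M\<^esub> \<rho> y i"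
      using i xy \<rho>_N N_add by (intro \<rho>_eq) auto
  next
    fix r x assume rx: "r \<in> carrier R" "x \<in> carrier M"
    have c: "\<rho> x \<in> I \<rightarrow> carrier M"
      using \<rho>_N rx N_carrier by auto
    have "r \<odot>\<^bsub>M\<^esub> x = r \<odot>\<^bsub>M\<^esub> (\<Oplus>\<^bsub>M\<^esub>i\<in>I. \<rho> x i)"
      using \<rho>(2)[OF rx(2)] by simp
    also have "\<dots> = (\<Oplus>\<^bsub>M\<^esub>i\<in>I. r \<odot>\<^bsub>M\<^esub> \<rho> x i)"
      using finsum_rsmult[OF fin c rx(1)] by simp
    finally show "\<rho> (r \<odot>\<^bsub>M\<^esub> x) i = r \<odot>\<^bsub>M\<^esub> \<rho> x i"
      using i rx \<rho>_N N_smult by (intro \<rho>_eq) auto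
  next
    fix x assume x: "x \<in> N i"
    have "x = (\<Oplus>\<^bsub>M\<^esub>j\<in>I. if i = j then x else \<zero>\<^bsub>M\<^esub>)"
      using M.finsum_singleton[OF i fin, of "\<lambda>_. x"] x N_carrier[OF i] by simp
    then have "\<rho> x i = (if i = i then x else \<zero>\<^bsub>M\<^esub>)"
      using x i N_zero by (intro \<rho>_eq) auto
    then show "\<rho> x i = x"
      by simp
  qed
  then show thesis
    using \<rho>(2) by (rule that)
qed

text \<open>
  The preimages of the \<open>K \<inter> N i\<close> under the projections \<open>\<pi> i\<close> are essential in \<open>M\<close>, hence so is
  their intersection. An element of it has all its components in \<open>K\<close>, so it is itself in \<open>K\<close>.
\<close>

lemma essential_if_essential_components:
  assumes "finite I" and N: "\<And>i. i \<in> I \<Longrightarrow> submodule (N i) R M"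
    and \<pi>: "\<And>i. i \<in> I \<Longrightarrow> module_projection R M (N i) (\<pi> i)"
    and sum: "\<And>x. x \<in> carrier M \<Longrightarrow> x = (\<Oplus>\<^bsub>M\<^esub>i\<in>I. \<pi> i x)"
    and K: "submodule K R M"
    and ess: "\<And>i. i \<in> I \<Longrightarrow> essential_submodule (K \<inter> N i) R (M\<lparr>carrier := N i\<rparr>)"
  shows "essential_submodule K R M"
proof -
  have "essential_submodule {x \<in> carrier M. \<forall>i\<in>J. \<pi> i x \<in> K} R M" if "finite J" "J \<subseteq> I" for J
    using that
  proof (induction J rule: finite_induct)
    case empty
    show ?case
      using essential_carrier by simp
  next
    case (insert i J)
    then have i: "i \<in> I" by simp
    have "\<pi> i \<in> module_Hom R M (M\<lparr>carrier := N i\<rparr>)" and im: "\<And>x. x \<in> carrier M \<Longrightarrow> \<pi> i x \<in> N i"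
      using \<pi>[OF i] by (auto simp: module_projection_def module_Hom_def)
    then have "essential_submodule {x \<in> carrier M. \<pi> i x \<in> K \<inter> N i} R M"
      using essential_vimage[OF right_module_axioms submodule_is_right_module[OF N[OF i]] _ ess[OF i]]
      by blast
    then have "essential_submodule
        ({x \<in> carrier M. \<pi> i x \<in> K \<inter> N i} \<inter> {x \<in> carrier M. \<forall>i\<in>J. \<pi> i x \<in> K}) R M"
      using insert by (intro essential_Int) auto
    also have "{x \<in> carrier M. \<pi> i x \<in> K \<inter> N i} \<inter> {x \<in> carrier M. \<forall>i\<in>J. \<pi> i x \<in> K} =
        {x \<in> carrier M. \<forall>i\<in>insert i J. \<pi> i x \<in> K}"
      using im by auto
    finally show ?case .
  qed
  then have "essential_submodule {x \<in> carrier M. \<forall>i\<in>I. \<pi> i x \<in> K} R M"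
    using \<open>finite I\<close> by blast
  moreover have "{x \<in> carrier M. \<forall>i\<in>I. \<pi> i x \<in> K} \<subseteq> K"
  proof safe
    fix x assume x: "x \<in> carrier M" "\<forall>i\<in>I. \<pi> i x \<in> K"
    then have "(\<Oplus>\<^bsub>M\<^esub>i\<in>I. \<pi> i x) \<in> K"
      by (intro submodule_finsum[OF K \<open>finite I\<close>]) auto
    then show "x \<in> K"
      using sum[OF x(1)] by simp
  qed
  ultimately show ?thesis
    using K by (rule essential_mono)
qed

end

section \<open>Endomorphisms of the direct sum\<close>

text \<open>
  This makes the kernel essential on one component \<open>H\<close> without making it smaller, and in such a way
  that the desired conclusion descends to the original kernel. If \<open>ker \<phi> \<inter> H\<close> is essential in \<open>D\<close>
  and \<open>H = D \<oplus> C\<close>, the right choice is \<open>\<psi> = \<phi> \<circ> p\<close>, where \<open>p\<close> is a projection with kernel \<open>C\<close> that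
  fixes \<open>ker \<phi>\<close> pointwise. On \<open>H\<close> its kernel contains the preimage of \<open>ker \<phi> \<inter> H\<close> under the
  projection \<open>d\<close> onto \<open>D\<close> along \<open>C\<close>, and this is essential.
\<close>

lemma (in right_module) enlarge_kernel:
  assumes C2: "C2_module R M" and \<phi>: "\<phi> \<in> module_Hom R M M"
    and H: "direct_summand H R M"
    and ker: "essential_in_summand (a_kernel M M \<phi> \<inter> H) R (M\<lparr>carrier := H\<rparr>)"
  obtains \<psi> where "\<psi> \<in> module_Hom R M M"
    "a_kernel M M \<phi> \<subseteq> a_kernel M M \<psi>"
    "essential_submodule (a_kernel M M \<psi> \<inter> H) R (M\<lparr>carrier := H\<rparr>)"
    "essential_in_summand (a_kernel M M \<psi>) R M \<Longrightarrow> essential_in_summand (a_kernel M M \<phi>) R M"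
proof -
  have sH: "submodule H R M"
    by (rule direct_summand_submodule[OF H])
  then have cH: "H \<subseteq> carrier M"
    by (rule submodule_subset)
  interpret H: right_module R "M\<lparr>carrier := H\<rparr>"
    by (rule submodule_is_right_module[OF sH])
  obtain h where "module_projection R M H h"
    using H direct_summand_iff_projection by blast
  then have h: "h \<in> module_Hom R M (M\<lparr>carrier := H\<rparr>)" and h_id: "\<And>x. x \<in> H \<Longrightarrow> h x = x"
    and h_im: "\<And>x. x \<in> carrier M \<Longrightarrow> h x \<in> H"
    by (auto simp: module_projection_def module_Hom_def)
  obtain D where D: "direct_summand D R (M\<lparr>carrier := H\<rparr>)"
    and ess: "essential_submodule (a_kernel M M \<phi> \<inter> H) R (M\<lparr>carrier := D\<rparr>)"
    using ker by (auto simp: essential_in_summand_def)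
  have sD': "submodule D R (M\<lparr>carrier := H\<rparr>)"
    by (rule H.direct_summand_submodule[OF D])
  then have sD: "submodule D R M" and DH: "D \<subseteq> H"
    using submodule_restrict_iff[OF sH] by auto
  obtain d where d: "module_projection R (M\<lparr>carrier := H\<rparr>) D d"
    using D H.direct_summand_iff_projection by blast
  then have d_hom: "d \<in> module_Hom R (M\<lparr>carrier := H\<rparr>) (M\<lparr>carrier := H\<rparr>)"
    and d_im: "\<And>x. x \<in> H \<Longrightarrow> d x \<in> D" and d_id: "\<And>x. x \<in> D \<Longrightarrow> d x = x"
    by (auto simp: module_projection_def)
  define C where "C = {x \<in> H. d x = \<zero>\<^bsub>M\<^esub>}"
  have C': "submodule C R (M\<lparr>carrier := H\<rparr>)"
    and c': "\<exists>c. module_projection R (M\<lparr>carrier := H\<rparr>) C c"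
    using H.projection_kernel_complement[OF sD' d] by (auto simp: C_def)
  then obtain c where c: "module_projection R (M\<lparr>carrier := H\<rparr>) C c"
    by blast
  have sC: "submodule C R M" and CH: "C \<subseteq> H"
    using C' submodule_restrict_iff[OF sH] by auto
  have "(\<lambda>x. c (h x)) \<in> module_Hom R M (M\<lparr>carrier := H\<rparr>)"
    using c Hom_compose[OF h] by (auto simp: module_projection_def)
  then have "module_projection R M C (\<lambda>x. c (h x))"
    using c h_im h_id CH cH by (auto simp: module_projection_def module_Hom_def)
  then have C: "direct_summand C R M"
    using sC direct_summand_iff_projection by blast
  have KD: "a_kernel M M \<phi> \<inter> H \<subseteq> D"
    by (rule essential_restrictD(2)[OF sD ess])
  have "x = \<zero>\<^bsub>M\<^esub>" if "x \<in> C" "\<phi> x = \<zero>\<^bsub>M\<^esub>" for x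
  proof -
    have "x \<in> D"
      using that KD CH cH by (auto simp: a_kernel_def')
    then show ?thesis
      using that d_id by (simp add: C_def)
  qed
  then obtain e where e: "module_projection R M C e"
    and e_ker: "\<And>x. x \<in> carrier M \<Longrightarrow> \<phi> x = \<zero>\<^bsub>M\<^esub> \<Longrightarrow> e x = \<zero>\<^bsub>M\<^esub>"
    using C2_projection_vanishing_on_kernel[OF C2 \<phi> C] by blast
  define P where "P = {x \<in> carrier M. e x = \<zero>\<^bsub>M\<^esub>}"
  define p where "p x = x \<ominus>\<^bsub>M\<^esub> e x" for x
  have sP: "submodule P R M" and p: "module_projection R M P p"
    unfolding P_def p_def using projection_kernel_complement[OF sC e] by auto
  have p_hom: "p \<in> module_Hom R M M" and p_im: "\<And>x. x \<in> carrier M \<Longrightarrow> p x \<in> carrier M"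
    and p_id: "\<And>x. x \<in> P \<Longrightarrow> p x = x"
    using p by (auto simp: module_projection_def P_def)
  have sK: "submodule (a_kernel M M \<phi>) R M"
    using submodule_vimage[OF right_module_axioms right_module_axioms \<phi> zero_submodule]
    by (simp add: a_kernel_def')
  have KP: "a_kernel M M \<phi> \<subseteq> P"
    using e_ker by (auto simp: a_kernel_def' P_def)
  have \<psi>: "(\<lambda>x. \<phi> (p x)) \<in> module_Hom R M M"
    by (rule Hom_compose[OF p_hom \<phi>])
  have ker_\<psi>: "a_kernel M M (\<lambda>x. \<phi> (p x)) = {x \<in> carrier M. p x \<in> a_kernel M M \<phi>}"
    using p_im by (auto simp: a_kernel_def')
  have "essential_submodule {x \<in> carrier (M\<lparr>carrier := H\<rparr>). d x \<in> a_kernel M M \<phi> \<inter> H}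
      R (M\<lparr>carrier := H\<rparr>)"
  proof (rule essential_vimage[OF H.right_module_axioms submodule_is_right_module[OF sD] _ ess])
    show "d \<in> module_Hom R (M\<lparr>carrier := H\<rparr>) (M\<lparr>carrier := D\<rparr>)"
      using d_hom d_im by (auto simp: module_Hom_def)
  qed
  (* If d x is in the kernel of \<phi>, then p fixes d x. As p vanishes on x - d x, which lies in C,
     p x = d x. *)
  moreover have "{x \<in> carrier (M\<lparr>carrier := H\<rparr>). d x \<in> a_kernel M M \<phi> \<inter> H}
      \<subseteq> a_kernel M M (\<lambda>x. \<phi> (p x)) \<inter> H"
  proof safe
    fix x assume "x \<in> carrier (M\<lparr>carrier := H\<rparr>)" and dx: "d x \<in> a_kernel M M \<phi>" "d x \<in> H"
    then have x: "x \<in> H" "x \<in> carrier M" "d x \<in> carrier M" "d x \<in> D"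
      using cH d_im by auto
    have "x \<ominus>\<^bsub>M\<^esub> d x \<in> H"
      by (rule submodule_minus[OF sH x(1) dx(2)])
    moreover have "d x \<oplus>\<^bsub>M\<^esub> d (x \<ominus>\<^bsub>M\<^esub> d x) = d x"
    proof -
      have "d x = d (d x \<oplus>\<^bsub>M\<^esub> (x \<ominus>\<^bsub>M\<^esub> d x))"
        using x minus_add_cancel by simp
      also have "\<dots> = d (d x) \<oplus>\<^bsub>M\<^esub> d (x \<ominus>\<^bsub>M\<^esub> d x)"
        using Hom_add[OF d_hom, of "d x" "x \<ominus>\<^bsub>M\<^esub> d x"] dx(2) \<open>x \<ominus>\<^bsub>M\<^esub> d x \<in> H\<close> by simp
      finally show ?thesis
        using d_id[OF x(4)] by simp
    qed
    moreover have "d (x \<ominus>\<^bsub>M\<^esub> d x) \<in> carrier M"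
      using d_im[OF \<open>x \<ominus>\<^bsub>M\<^esub> d x \<in> H\<close>] DH cH by blast
    ultimately have xC: "x \<ominus>\<^bsub>M\<^esub> d x \<in> C"
      using M.add.r_cancel_one[of "d x" "d (x \<ominus>\<^bsub>M\<^esub> d x)"] M.a_comm x by (simp add: C_def)
    have "p (x \<ominus>\<^bsub>M\<^esub> d x) = \<zero>\<^bsub>M\<^esub>"
      using xC e x by (auto simp: p_def module_projection_def minus_eq_zero_iff)
    then have "p x = p (d x)"
      using x p_im Hom_minus[OF right_module_axioms right_module_axioms p_hom x(2,3)] minus_eq_zero_iff
      by auto
    also have "\<dots> = d x"
      using dx KP p_id by blast
    finally show "x \<in> a_kernel M M (\<lambda>x. \<phi> (p x))"
      using dx x by (simp add: ker_\<psi>)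
  qed simp
  moreover have "submodule (a_kernel M M (\<lambda>x. \<phi> (p x)) \<inter> H) R (M\<lparr>carrier := H\<rparr>)"
    using submodule_vimage[OF right_module_axioms right_module_axioms p_hom sK] sH
    by (simp add: ker_\<psi> submodule_restrict_iff[OF sH] submodule_Int)
  ultimately have "essential_submodule (a_kernel M M (\<lambda>x. \<phi> (p x)) \<inter> H) R (M\<lparr>carrier := H\<rparr>)"
    by (rule H.essential_mono)
  moreover have "essential_in_summand (a_kernel M M \<phi>) R M"
    if "essential_in_summand (a_kernel M M (\<lambda>x. \<phi> (p x))) R M"
    using that essential_in_summand_if_vimage[OF sP p sK KP]
    unfolding ker_\<psi> essential_in_summand_def by blast
  moreover have "a_kernel M M \<phi> \<subseteq> a_kernel M M (\<lambda>x. \<phi> (p x))"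
    using KP p_id by (auto simp: ker_\<psi> a_kernel_def')
  ultimately show thesis
    using \<psi> that by blast
qed

theorem theorem3p7:
  fixes R :: "('a, 'r) ring_scheme"
    and M :: "('a, 'b, 'm) module_scheme"
    and N :: "nat \<Rightarrow> 'b set"
    and n :: nat
  assumes "ring R" and "\<one>\<^bsub>R\<^esub> \<noteq> \<zero>\<^bsub>R\<^esub>"
    and "right_module R M"
    and "finite_direct_sum R M {1..n} N"
    and "C2_module R M"
    and "\<And>i j. i \<in> {1..n} \<Longrightarrow> j \<in> {1..n} \<Longrightarrow>
           relatively_CS_Rickart R (M\<lparr>carrier := N i\<rparr>) (M\<lparr>carrier := N j\<rparr>)"
  shows "CS_Rickart R M"
proof -
  interpret right_module R M by fact
  let ?I = "{1..n}"
  have N: "\<And>i. i \<in> ?I \<Longrightarrow> submodule (N i) R M"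
    using assms(4) by (simp add: finite_direct_sum_def)
  obtain \<pi> where \<pi>: "\<And>i. i \<in> ?I \<Longrightarrow> module_projection R M (N i) (\<pi> i)"
    and sum: "\<And>x. x \<in> carrier M \<Longrightarrow> x = (\<Oplus>\<^bsub>M\<^esub>i\<in>?I. \<pi> i x)"
    using finite_direct_sum_projections[OF assms(4)] by blast
  have summand: "direct_summand (N i) R M" if "i \<in> ?I" for i
    using that N \<pi> direct_summand_iff_projection by blast
  have kernel_component: "essential_in_summand (a_kernel M M \<phi> \<inter> N i) R (M\<lparr>carrier := N i\<rparr>)"
    if \<phi>: "\<phi> \<in> module_Hom R M M" and i: "i \<in> ?I" for \<phi> i
  proof -
    have cN: "N i \<subseteq> carrier M"
      by (rule submodule_subset[OF N[OF i]])
    have "(\<lambda>x. \<pi> j (\<phi> x)) \<in> module_Hom R (M\<lparr>carrier := N i\<rparr>) (M\<lparr>carrier := N j\<rparr>)" if "j \<in> ?I" for j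
    proof -
      have "\<pi> j \<in> module_Hom R M (M\<lparr>carrier := N j\<rparr>)"
        using \<pi>[OF that] by (auto simp: module_projection_def module_Hom_def)
      then have "(\<lambda>x. \<pi> j (\<phi> x)) \<in> module_Hom R M (M\<lparr>carrier := N j\<rparr>)"
        by (rule Hom_compose[OF \<phi>])
      with Hom_inclusion[OF N[OF i]] show ?thesis
        by (rule Hom_compose)
    qed
    then have "essential_in_summand {x \<in> carrier (M\<lparr>carrier := N i\<rparr>).
        \<forall>j\<in>?I. \<pi> j (\<phi> x) = \<zero>\<^bsub>M\<lparr>carrier := N j\<rparr>\<^esub>} R (M\<lparr>carrier := N i\<rparr>)"
      using i N submodule_is_right_module assms(6)
      by (intro relatively_CS_Rickart_Int_kernels) auto
    moreover have "(\<forall>j\<in>?I. \<pi> j y = \<zero>\<^bsub>M\<^esub>) \<longleftrightarrow> y = \<zero>\<^bsub>M\<^esub>" if y: "y \<in> carrier M" for y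
    proof
      assume z: "\<forall>j\<in>?I. \<pi> j y = \<zero>\<^bsub>M\<^esub>"
      have "(\<Oplus>\<^bsub>M\<^esub>j\<in>?I. \<pi> j y) \<in> {\<zero>\<^bsub>M\<^esub>}"
        by (rule submodule_finsum[OF zero_submodule]) (use z in auto)
      then show "y = \<zero>\<^bsub>M\<^esub>"
        using sum[OF y] by simp
    next
      assume "y = \<zero>\<^bsub>M\<^esub>"
      then show "\<forall>j\<in>?I. \<pi> j y = \<zero>\<^bsub>M\<^esub>"
        using Hom_zero[OF right_module_axioms right_module_axioms] \<pi>
        by (auto simp: module_projection_def)
    qed
    then have "{x \<in> carrier (M\<lparr>carrier := N i\<rparr>). \<forall>j\<in>?I. \<pi> j (\<phi> x) = \<zero>\<^bsub>M\<lparr>carrier := N j\<rparr>\<^esub>} =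
        a_kernel M M \<phi> \<inter> N i"
      using cN Hom_closed[OF \<phi>] by (auto simp: a_kernel_def')
    ultimately show ?thesis
      by simp
  qed
  have ker_submodule: "submodule (a_kernel M M \<phi>) R M" if "\<phi> \<in> module_Hom R M M" for \<phi>
    using submodule_vimage[OF right_module_axioms right_module_axioms that zero_submodule]
    by (simp add: a_kernel_def')
  (* J contains the components on which the kernel may still fail to be essential. *)
  have "essential_in_summand (a_kernel M M \<phi>) R M"
    if "finite J" "\<phi> \<in> module_Hom R M M"
      "\<And>i. i \<in> ?I - J \<Longrightarrow> essential_submodule (a_kernel M M \<phi> \<inter> N i) R (M\<lparr>carrier := N i\<rparr>)" for J \<phi>
    using that
  proof (induction J arbitrary: \<phi> rule: finite_induct)
    case empty
    have "essential_submodule (a_kernel M M \<phi>) R M"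
      using empty by (intro essential_if_essential_components[OF _ N \<pi> sum] ker_submodule) auto
    then show ?case
      using direct_summand_carrier by (auto simp: essential_in_summand_def)
  next
    case (insert i J)
    show ?case
    proof (cases "i \<in> ?I")
      case True
      obtain \<psi> where \<psi>: "\<psi> \<in> module_Hom R M M"
        and sub: "a_kernel M M \<phi> \<subseteq> a_kernel M M \<psi>"
        and ess: "essential_submodule (a_kernel M M \<psi> \<inter> N i) R (M\<lparr>carrier := N i\<rparr>)"
        and descend: "essential_in_summand (a_kernel M M \<psi>) R M \<Longrightarrow>
          essential_in_summand (a_kernel M M \<phi>) R M"
        using enlarge_kernel[OF assms(5) insert.prems(1) summand[OF True]
            kernel_component[OF insert.prems(1) True]] by blast
      have "essential_submodule (a_kernel M M \<psi> \<inter> N k) R (M\<lparr>carrier := N k\<rparr>)" if k: "k \<in> ?I - J" for k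
      proof (cases "k = i")
        case False
        then have Nk: "submodule (N k) R M"
          and "essential_submodule (a_kernel M M \<phi> \<inter> N k) R (M\<lparr>carrier := N k\<rparr>)"
          using k N insert.prems(2) by auto
        moreover have "submodule (a_kernel M M \<psi> \<inter> N k) R (M\<lparr>carrier := N k\<rparr>)"
          using Nk ker_submodule[OF \<psi>] by (simp add: submodule_restrict_iff submodule_Int)
        ultimately show ?thesis
          using sub right_module.essential_mono[OF submodule_is_right_module[OF Nk]] by blast
      qed (use ess in simp)
      then show ?thesis
        using insert.IH[OF \<psi>] descend by blast
    next
      case False
      then show ?thesis
        using insert by auto
    qed
  qed
  from this[of ?I] show ?thesis
    by (auto simp: CS_Rickart_def essential_in_summand_def)
qed

end
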